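(* For $i=1,2$ let $\xi_i:[0,1]\to\mathbb{R}$ be a non-random function with continuous first derivative such that $\xi_i'$ vanishes at most on a countable subset of $[0,1]$. Let $a_{i,sh}, a_{i,sc}$ be real random variables with $P(a_{i,sc}=0)=0$, and define the random function $f_i(t)=a_{i,sh}+a_{i,sc}\,\xi_i(t)$, $t\in[0,1]$. Let $h_i$ be a random function on $[0,1]$ which, with probability one, is continuous with strictly positive and continuous first derivative and satisfies $h_i(0)=0$, $h_i(1)=1$; assume moreover that $\mathrm{E}[h_i^{-1}(t)]=t$ for all $t\in[0,1]$. Set $\tilde f_i=f_i\circ h_i$. Then $$\tilde f_1 \overset{d}{=} \tilde f_2 \quad\text{if and only if}\quad (f_1,h_1)\overset{d}{=}(f_2,h_2).$$
   Context: $X_1\overset{d}{=}X_2$ means $X_1$ and $X_2$ have the same distribution. Random functions are regarded as random elements of $C^1[0,1]$ (functions $[0,1]\to\mathbb{R}$ with continuous first derivative) equipped with the metric $d(f,g)=\sup_t|f(t)-g(t)|+\sup_t|f'(t)-g'(t)|$ and its Borel $\sigma$-algebra; pairs of functions are regarded as random elements of $C^1[0,1]\times C^1[0,1]$ with the product metric. $h_i^{-1}$ denotes the inverse function of $h_i$. *)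

theory Defs
  imports "HOL-Probability.Probability"
begin

text \<open>Functions in C^1[0,1] are represented as functions real => real that vanish
  outside [0,1] (canonical representative), derivatives being one-sided at the endpoints.\<close>

definition is_C1 :: "(real \<Rightarrow> real) \<Rightarrow> bool" where
  "is_C1 g \<longleftrightarrow> (\<exists>g'. continuous_on {0..1} g' \<and>
      (\<forall>t\<in>{0..1}. (g has_real_derivative g' t) (at t within {0..1})))"

definition C1 :: "(real \<Rightarrow> real) set" where
  "C1 = {g. is_C1 g \<and> (\<forall>t. t \<notin> {0..1} \<longrightarrow> g t = 0)}"

definition dC1 :: "(real \<Rightarrow> real) \<Rightarrow> real \<Rightarrow> real" where
  "dC1 g t = vector_derivative g (at t within {0..1})"

definition c1_dist :: "(real \<Rightarrow> real) \<Rightarrow> (real \<Rightarrow> real) \<Rightarrow> real" where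
  "c1_dist f g = (SUP t\<in>{0..1}. \<bar>f t - g t\<bar>) + (SUP t\<in>{0..1}. \<bar>dC1 f t - dC1 g t\<bar>)"

definition c1_borel :: "(real \<Rightarrow> real) measure" where
  "c1_borel = sigma C1 {U. U \<subseteq> C1 \<and>
     (\<forall>f\<in>U. \<exists>e>0. \<forall>g\<in>C1. c1_dist f g < e \<longrightarrow> g \<in> U)}"

definition c1_pair_borel :: "((real \<Rightarrow> real) \<times> (real \<Rightarrow> real)) measure" where
  "c1_pair_borel = sigma (C1 \<times> C1) {U. U \<subseteq> C1 \<times> C1 \<and>
     (\<forall>p\<in>U. \<exists>e>0. \<forall>q\<in>C1 \<times> C1.
        c1_dist (fst p) (fst q) + c1_dist (snd p) (snd q) < e \<longrightarrow> q \<in> U)}"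

definition lin_fun :: "real \<Rightarrow> real \<Rightarrow> (real \<Rightarrow> real) \<Rightarrow> real \<Rightarrow> real" where
  "lin_fun ash asc \<xi> = (\<lambda>t. if t \<in> {0..1} then ash + asc * \<xi> t else 0)"

definition good_warp :: "(real \<Rightarrow> real) \<Rightarrow> bool" where
  "good_warp h \<longleftrightarrow> h \<in> C1 \<and> h 0 = 0 \<and> h 1 = 1 \<and> (\<forall>t\<in>{0..1}. dC1 h t > 0)"

definition warp_inv :: "(real \<Rightarrow> real) \<Rightarrow> real \<Rightarrow> real" where
  "warp_inv h t = (THE s. s \<in> {0..1} \<and> h s = t)"

text \<open>f o h, defined (arbitrarily as 0) on the null event where h is not a good warping\<close>
definition warp_comp :: "(real \<Rightarrow> real) \<Rightarrow> (real \<Rightarrow> real) \<Rightarrow> real \<Rightarrow> real" where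
  "warp_comp f h = (if good_warp h then (\<lambda>t. if t \<in> {0..1} then f (h t) else 0) else (\<lambda>_. 0))"

end

theory Submission
  imports Defs
begin

text \<open>
  The total variation of \<open>f \<circ> h\<close> on \<open>[0,t]\<close>, divided by its total variation on \<open>[0,1]\<close>, equals
  \<open>G (h t)\<close>, where \<open>G\<close> is the normalised variation of \<open>\<xi>\<close>: shift and scale cancel. As \<open>\<xi>'\<close> has only
  countably many zeros, \<open>G\<close> is an increasing homeomorphism of \<open>[0,1]\<close>. So the inverse of the
  normalised variation is \<open>h\<^sup>-\<^sup>1 \<circ> G\<^sup>-\<^sup>1\<close>, with expectation \<open>G\<^sup>-\<^sup>1\<close>. Hence the law of \<open>f \<circ> h\<close>
  determines \<open>G\<close>, and once \<open>G\<close> is known, \<open>h\<close> and \<open>f\<close> are measurable functionals of the path \<open>f \<circ> h\<close>.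
  All measurability questions reduce to point evaluations, because the Borel \<open>\<sigma>\<close>-algebra of \<open>C\<^sup>1[0,1]\<close> is the
  trace of the product \<open>\<sigma>\<close>-algebra.
\<close>

section \<open>Approximation of points of [0,1] by rational grid points\<close>

definition grid :: "nat \<Rightarrow> real \<Rightarrow> real" where
  "grid n t = of_int \<lfloor>real (Suc n) * t\<rfloor> / real (Suc n)"

lemma grid_Rats: "grid n t \<in> \<rat>"
  unfolding grid_def by simp

lemma grid_bounds: "grid n t \<le> t" "t < grid n t + 1 / real (Suc n)"
proof -
  have "real_of_int \<lfloor>real (Suc n) * t\<rfloor> \<le> real (Suc n) * t"
    by linarith
  then show "grid n t \<le> t"
    unfolding grid_def by (simp add: field_simps)
  have "real (Suc n) * t < of_int \<lfloor>real (Suc n) * t\<rfloor> + 1" by linarith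
  then show "t < grid n t + 1 / real (Suc n)"
    unfolding grid_def by (simp add: field_simps)
qed

lemma grid_in_unit: "t \<in> {0..1} \<Longrightarrow> grid n t \<in> {0..1}"
  using grid_bounds(1)[of n t] order_trans[of "grid n t" t 1]
  by (simp add: grid_def zero_le_divide_iff del: of_nat_Suc)

lemma grid_tendsto: "(\<lambda>n. grid n t) \<longlonglongrightarrow> t"
proof (rule real_tendsto_sandwich[where f = "\<lambda>n. t - 1 / real (Suc n)" and h = "\<lambda>_. t"])
  show "\<forall>\<^sub>F n in sequentially. t - 1 / real (Suc n) \<le> grid n t"
    using grid_bounds(2)[of t] by (intro always_eventually allI) (smt (verit))
  show "(\<lambda>n. t - 1 / real (Suc n)) \<longlonglongrightarrow> t"
    using tendsto_diff[OF tendsto_const LIMSEQ_inverse_real_of_nat, of t]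
    by (simp add: inverse_eq_divide)
qed (auto simp: grid_bounds)

lemma continuous_on_grid:
  assumes "continuous_on {0..1} F" "t \<in> {0..1}"
  shows "(\<lambda>n. F (grid n t)) \<longlonglongrightarrow> F t"
  by (rule continuous_on_tendsto_compose[OF assms(1) grid_tendsto assms(2)])
     (intro always_eventually allI grid_in_unit assms(2))

text \<open>Grid points are rational and converge to \<open>t\<close>, so continuity carries the
  bound over. This turns uniform estimates into countably many conditions, as needed for
  measurability.\<close>

lemma bound_from_rationals:
  fixes F :: "real \<Rightarrow> real"
  assumes "continuous_on {0..1} F" "\<And>t. t \<in> \<rat> \<inter> {0..1} \<Longrightarrow> F t \<le> c" "t \<in> {0..1}"
  shows "F t \<le> c"
  by (rule LIMSEQ_le_const2[OF continuous_on_grid[OF assms(1,3)]])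
     (use assms(2) grid_Rats grid_in_unit[OF assms(3)] in blast)

section \<open>Elementary properties of \<open>C1\<close> and its metric\<close>

lemma dC1_eqI:
  assumes "(g has_real_derivative D) (at t within {0..1})" "t \<in> {0..1}"
  shows "dC1 g t = D"
  unfolding dC1_def
  using assms
  by (intro vector_derivative_within_closed_interval)
     (auto simp: has_real_derivative_iff_has_vector_derivative)

lemma C1_has_derivative:
  assumes "g \<in> C1" "t \<in> {0..1}"
  shows "(g has_real_derivative dC1 g t) (at t within {0..1})"
  using assms dC1_eqI unfolding C1_def is_C1_def by fastforce

lemma C1_continuous_deriv:
  assumes "g \<in> C1"
  shows "continuous_on {0..1} (dC1 g)"
proof -
  obtain g' where g': "continuous_on {0..1} g'"
    "\<forall>t\<in>{0..1}. (g has_real_derivative g' t) (at t within {0..1})"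
    using assms unfolding C1_def is_C1_def by blast
  then show ?thesis
    by (subst continuous_on_cong[OF refl, of _ _ g']) (auto simp: dC1_eqI)
qed

lemma C1_continuous: "g \<in> C1 \<Longrightarrow> continuous_on {0..1} g"
  by (meson C1_has_derivative DERIV_continuous_on)

lemma C1_outside: "g \<in> C1 \<Longrightarrow> t \<notin> {0..1} \<Longrightarrow> g t = 0"
  unfolding C1_def by blast

lemma C1I:
  assumes "continuous_on {0..1} g'"
    "\<And>t. t \<in> {0..1} \<Longrightarrow> (g has_real_derivative g' t) (at t within {0..1})"
    "\<And>t. t \<notin> {0..1} \<Longrightarrow> g t = 0"
  shows "g \<in> C1"
  using assms unfolding C1_def is_C1_def by blast

lemma C1_diff_bounded:
  assumes "f \<in> C1" "g \<in> C1"
  shows "bdd_above ((\<lambda>t. \<bar>f t - g t\<bar>) ` {0..1})"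
    and "bdd_above ((\<lambda>t. \<bar>dC1 f t - dC1 g t\<bar>) ` {0..1})"
  by (intro compact_imp_bounded bounded_imp_bdd_above compact_continuous_image continuous_intros
      C1_continuous C1_continuous_deriv assms compact_Icc)+

text \<open>Makes evaluation at \<open>t\<close> 1-Lipschitz on \<open>C1\<close>. It covers every
  real \<open>t\<close>, since members of \<open>C1\<close> vanish outside [0,1].\<close>

lemma c1_dist_ge:
  assumes "f \<in> C1" "g \<in> C1"
  shows "\<bar>f t - g t\<bar> \<le> c1_dist f g"
proof -
  have nonneg: "0 \<le> (SUP t\<in>{0..1}. \<bar>f t - g t\<bar>)" "0 \<le> (SUP t\<in>{0..1}. \<bar>dC1 f t - dC1 g t\<bar>)"
    using C1_diff_bounded[OF assms] by (auto intro!: cSUP_upper2[where x = "0::real"])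
  show ?thesis
  proof (cases "t \<in> {0..1}")
    case True
    then have "\<bar>f t - g t\<bar> \<le> (SUP t\<in>{0..1}. \<bar>f t - g t\<bar>)"
      by (rule cSUP_upper[OF _ C1_diff_bounded(1)[OF assms]])
    then show ?thesis unfolding c1_dist_def using nonneg by linarith
  next
    case False
    then show ?thesis unfolding c1_dist_def using nonneg assms by (simp add: C1_outside)
  qed
qed

section \<open>The Borel \<sigma>-algebra of \<open>C1\<close> as a trace of the product
  \<sigma>-algebra\<close>

abbreviation fun_borel :: "(real \<Rightarrow> real) measure" where
  "fun_borel \<equiv> PiM UNIV (\<lambda>_. borel)"

lemma measurable_C1_eval:
  "(\<lambda>g. g t) \<in> borel_measurable (restrict_space fun_borel C1)"
  by (intro measurable_restrict_space1 measurable_component_singleton) simp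

lemma space_C1_trace: "space (restrict_space fun_borel C1) = C1"
  by (simp add: space_restrict_space space_PiM)

lemma difference_quotient_tendsto:
  assumes "(g has_real_derivative D) (at t within S)" "\<And>n. X n \<in> S - {t}" "X \<longlonglongrightarrow> t"
  shows "(\<lambda>n. (g (X n) - g t) / (X n - t)) \<longlonglongrightarrow> D"
proof -
  have "((\<lambda>y. (g y - g t) / (y - t)) \<longlongrightarrow> D) (at t within S)"
    using assms(1) by (simp add: has_field_derivative_iff)
  then have "((\<lambda>y. (g y - g t) / (y - t)) \<circ> X) \<longlonglongrightarrow> D"
    unfolding tendsto_at_iff_sequentially using assms(2,3) by blast
  then show ?thesis by (simp add: o_def)
qed

text \<open>One sequence \<open>X\<close> in [0,1] tending to \<open>t\<close> serves all
  \<open>g\<close>, so the derivative at \<open>t\<close> is a pointwise limit of difference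
  quotients, each a combination of two evaluations. One-sided derivatives at the endpoints need no
  separate case.\<close>

lemma measurable_C1_deriv:
  assumes "t \<in> {0..1}"
  shows "(\<lambda>g. dC1 g t) \<in> borel_measurable (restrict_space fun_borel C1)"
proof -
  have "t islimpt {0..1}" using assms by (simp add: islimpt_Icc)
  then obtain X where X: "\<And>n. X n \<in> {0..1} - {t}" "X \<longlonglongrightarrow> t"
    unfolding islimpt_sequential by blast
  show ?thesis
  proof (rule borel_measurable_LIMSEQ_real)
    fix g assume "g \<in> space (restrict_space fun_borel C1)"
    then show "(\<lambda>n. (g (X n) - g t) / (X n - t)) \<longlonglongrightarrow> dC1 g t"
      unfolding space_C1_trace
      by (intro difference_quotient_tendsto[where S = "{0..1}"] C1_has_derivative assms X)
  qed (intro borel_measurable_divide borel_measurable_diff measurable_C1_eval borel_measurable_const)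
qed

lemma pred_countable_Ball:
  assumes "countable A" "\<And>i. i \<in> A \<Longrightarrow> Measurable.pred M (P i)"
  shows "Measurable.pred M (\<lambda>x. \<forall>i\<in>A. P i x)"
  using assms unfolding pred_def by (intro sets.sets_Collect_countable_All') auto

text \<open>Countably many cells of small diameter: the list \<open>c\<close> records \<open>g 0\<close> and the values of \<open>g'\<close> on a
  grid fine enough for the modulus of continuity of \<open>g'\<close>, all rounded to multiples of \<open>1 / (n + 1)\<close>.\<close>

definition C1_cell :: "nat \<Rightarrow> nat \<Rightarrow> int list \<Rightarrow> (real \<Rightarrow> real) set" where
  "C1_cell n N c = {g \<in> C1. \<lfloor>real (Suc n) * g 0\<rfloor> = c ! 0 \<and>
     (\<forall>k\<in>{..Suc N}. \<lfloor>real (Suc n) * dC1 g (real k / real (Suc N))\<rfloor> = c ! Suc k) \<and>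
     (\<forall>s\<in>\<rat> \<inter> {0..1}. \<forall>t\<in>\<rat> \<inter> {0..1}. \<bar>s - t\<bar> \<le> 1 / real (Suc N)
        \<longrightarrow> \<bar>dC1 g s - dC1 g t\<bar> \<le> 1 / real (Suc n))}"

text \<open>The modulus condition is imposed at rational points only, so a cell is a countable
  intersection of conditions on \<open>g 0\<close> and on values of the derivative.\<close>

lemma C1_cell_measurable: "C1_cell n N c \<in> sets (restrict_space fun_borel C1)"
proof -
  let ?R = "restrict_space fun_borel C1"
  have Q: "countable (\<rat> \<inter> {0..1::real})" by (simp add: countable_rat)
  have "Measurable.pred ?R (\<lambda>g. \<lfloor>real (Suc n) * g 0\<rfloor> = c ! 0)"
    using measurable_C1_eval[of 0, measurable] by measurable
  moreover have "Measurable.pred ?R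
    (\<lambda>g. \<lfloor>real (Suc n) * dC1 g (real k / real (Suc N))\<rfloor> = c ! Suc k)" if "k \<le> Suc N" for k
  proof -
    have "real k / real (Suc N) \<in> {0..1}" using that by (auto simp: divide_le_eq_1 simp del: of_nat_Suc)
    from measurable_C1_deriv[OF this, measurable] show ?thesis by measurable
  qed
  then have "Measurable.pred ?R (\<lambda>g. \<forall>k\<in>{..Suc N}.
    \<lfloor>real (Suc n) * dC1 g (real k / real (Suc N))\<rfloor> = c ! Suc k)"
    by (intro pred_intros_finite) auto
  moreover have "Measurable.pred ?R (\<lambda>g. \<bar>s - t\<bar> \<le> 1 / real (Suc N)
        \<longrightarrow> \<bar>dC1 g s - dC1 g t\<bar> \<le> 1 / real (Suc n))" if "s \<in> {0..1}" "t \<in> {0..1}" for s t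
    using measurable_C1_deriv[of s, measurable] measurable_C1_deriv[of t, measurable] that
    by measurable
  then have "Measurable.pred ?R (\<lambda>g. \<forall>s\<in>\<rat> \<inter> {0..1}. \<forall>t\<in>\<rat> \<inter> {0..1}. \<bar>s - t\<bar> \<le> 1 / real (Suc N)
        \<longrightarrow> \<bar>dC1 g s - dC1 g t\<bar> \<le> 1 / real (Suc n))"
    by (rule pred_countable_Ball[OF Q pred_countable_Ball[OF Q]]) auto
  ultimately have "Measurable.pred ?R (\<lambda>g. \<lfloor>real (Suc n) * g 0\<rfloor> = c ! 0 \<and>
     (\<forall>k\<in>{..Suc N}. \<lfloor>real (Suc n) * dC1 g (real k / real (Suc N))\<rfloor> = c ! Suc k) \<and>
     (\<forall>s\<in>\<rat> \<inter> {0..1}. \<forall>t\<in>\<rat> \<inter> {0..1}. \<bar>s - t\<bar> \<le> 1 / real (Suc N)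
        \<longrightarrow> \<bar>dC1 g s - dC1 g t\<bar> \<le> 1 / real (Suc n)))"
    by (intro pred_intros_logic(3))
  from predE[OF this] show ?thesis
    unfolding C1_cell_def space_C1_trace by simp
qed

text \<open>Uniform continuity of \<open>g'\<close> on the compact interval supplies
  \<open>N\<close>; the list \<open>c\<close> is then read off from \<open>g\<close>.\<close>

lemma C1_cell_cover:
  assumes "g \<in> C1"
  shows "\<exists>N c. g \<in> C1_cell n N c"
proof -
  have "uniformly_continuous_on {0..1} (dC1 g)"
    by (intro compact_uniformly_continuous C1_continuous_deriv assms) simp
  then obtain d where d: "d > 0" "\<And>s t. s \<in> {0..1} \<Longrightarrow> t \<in> {0..1} \<Longrightarrow> \<bar>s - t\<bar> < d \<Longrightarrow>
      \<bar>dC1 g s - dC1 g t\<bar> < 1 / real (Suc n)"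
    unfolding uniformly_continuous_on_def dist_real_def
    by (metis of_nat_0_less_iff zero_less_Suc zero_less_divide_1_iff abs_minus_commute)
  obtain N where N: "1 / real (Suc N) < d"
    using d(1) by (metis inverse_eq_divide reals_Archimedean)
  \<comment> \<open>Slot 0 holds \<open>g 0\<close> and grid point \<open>k\<close> sits in slot
    \<open>Suc k\<close>; \<open>k\<close> runs up to \<open>Suc N\<close> so that the endpoint 1 is
    included.\<close>
  define c where "c = \<lfloor>real (Suc n) * g 0\<rfloor> #
    map (\<lambda>k. \<lfloor>real (Suc n) * dC1 g (real k / real (Suc N))\<rfloor>) [0..<Suc (Suc N)]"
  have "c ! Suc k = \<lfloor>real (Suc n) * dC1 g (real k / real (Suc N))\<rfloor>" if "k \<le> Suc N" for k
    unfolding c_def nth_Cons_Suc using that by (subst nth_map) (auto simp del: upt_Suc)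
  moreover have "c ! 0 = \<lfloor>real (Suc n) * g 0\<rfloor>" by (simp add: c_def)
  moreover have "\<bar>dC1 g s - dC1 g t\<bar> \<le> 1 / real (Suc n)"
    if "s \<in> {0..1}" "t \<in> {0..1}" "\<bar>s - t\<bar> \<le> 1 / real (Suc N)" for s t
    using d(2)[of s t] that N by linarith
  ultimately have "g \<in> C1_cell n N c"
    using assms unfolding C1_cell_def by auto
  then show ?thesis by blast
qed

lemma floor_eq_imp_close:
  fixes x y :: real
  assumes "\<lfloor>real (Suc n) * x\<rfloor> = \<lfloor>real (Suc n) * y\<rfloor>"
  shows "\<bar>x - y\<bar> \<le> 1 / real (Suc n)"
proof -
  have "\<bar>real (Suc n) * x - real (Suc n) * y\<bar> \<le> 1" using assms by linarith
  then have "real (Suc n) * \<bar>x - y\<bar> \<le> 1"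
    by (metis abs_mult abs_of_nat right_diff_distrib)
  then show ?thesis by (simp add: field_simps)
qed

text \<open>With e = 1/(n+1): going to the grid, comparing there and coming back costs 3e for the
  derivatives. Integrating this over a length of at most 1 and adding the error e at 0 costs 4e for
  the functions, 7e in total.\<close>

lemma C1_cell_small:
  assumes "f \<in> C1_cell n N c" "g \<in> C1_cell n N c"
  shows "c1_dist f g \<le> 7 / real (Suc n)"
proof -
  let ?e = "1 / real (Suc n)"
  have C1: "f \<in> C1" "g \<in> C1" using assms unfolding C1_cell_def by auto
  have rat: "\<bar>dC1 f t - dC1 g t\<bar> \<le> 3 * ?e" if t: "t \<in> \<rat> \<inter> {0..1}" for t
  proof -
    \<comment> \<open>The grid point at or just left of \<open>t\<close>; for \<open>t = 1\<close>
      the index is \<open>Suc N\<close>, the last one recorded in a cell.\<close>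
    define k where "k = nat \<lfloor>real (Suc N) * t\<rfloor>"
    have kt: "real k / real (Suc N) = grid N t"
      using t unfolding k_def grid_def by simp
    have r: "grid N t \<in> \<rat> \<inter> {0..1}" using t grid_Rats grid_in_unit by blast
    have k: "k \<le> Suc N"
    proof -
      have "real k / real (Suc N) \<le> 1" using r kt by simp
      then show ?thesis by (simp add: divide_le_eq_1 del: of_nat_Suc)
    qed
    have "\<bar>grid N t - t\<bar> \<le> 1 / real (Suc N)" using grid_bounds(1)[of N t] grid_bounds(2)[of t N] by linarith
    then have "\<bar>dC1 f (grid N t) - dC1 f t\<bar> \<le> ?e" "\<bar>dC1 g (grid N t) - dC1 g t\<bar> \<le> ?e"
      using assms r t unfolding C1_cell_def by blast+
    moreover have "\<bar>dC1 f (grid N t) - dC1 g (grid N t)\<bar> \<le> ?e"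
      using assms k unfolding C1_cell_def kt[symmetric] by (intro floor_eq_imp_close) auto
    ultimately show ?thesis by linarith
  qed
  have D: "\<bar>dC1 f t - dC1 g t\<bar> \<le> 3 * ?e" if "t \<in> {0..1}" for t
    by (rule bound_from_rationals[OF _ rat that])
       (intro continuous_intros C1_continuous_deriv C1)
  have F: "\<bar>f t - g t\<bar> \<le> 4 * ?e" if t: "t \<in> {0..1}" for t
  proof -
    have "norm ((f t - g t) - (f 0 - g 0)) \<le> 3 * ?e * norm (t - 0)"
      by (rule field_differentiable_bound[where S = "{0..1}" and f' = "\<lambda>t. dC1 f t - dC1 g t"])
         (use D t in \<open>auto intro!: DERIV_diff C1_has_derivative C1\<close>)
    also have "\<dots> \<le> 3 * ?e * 1" using t by (intro mult_left_mono) auto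
    finally have "\<bar>(f t - g t) - (f 0 - g 0)\<bar> \<le> 3 * ?e" by simp
    moreover have "\<bar>f 0 - g 0\<bar> \<le> ?e"
      using assms unfolding C1_cell_def by (intro floor_eq_imp_close) auto
    ultimately show ?thesis by linarith
  qed
  have "(SUP t\<in>{0..1}. \<bar>f t - g t\<bar>) \<le> 4 * ?e" "(SUP t\<in>{0..1}. \<bar>dC1 f t - dC1 g t\<bar>) \<le> 3 * ?e"
    by (intro cSUP_least; use D F in simp)+
  then show ?thesis unfolding c1_dist_def by simp
qed

text \<open>An open set is the union of the cells it contains, and there are only countably many
  cells. Conversely, evaluations are continuous for the metric, so they are Borel.\<close>

lemma sets_c1_borel: "sets c1_borel = sets (restrict_space fun_borel C1)"
proof (rule antisym)
  let ?R = "restrict_space fun_borel C1"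
  let ?O = "{U. U \<subseteq> C1 \<and> (\<forall>f\<in>U. \<exists>e>0. \<forall>g\<in>C1. c1_dist f g < e \<longrightarrow> g \<in> U)}"
  have O: "?O \<subseteq> Pow C1" by blast
  have "U \<in> sets ?R" if U: "U \<in> ?O" for U
  proof -
    \<comment> \<open>The triples range over a countable type, so \<open>I\<close> is countable
      whatever \<open>U\<close> is.\<close>
    define I where "I = {(n, N, c). C1_cell n N c \<subseteq> U}"
    have "U \<subseteq> (\<Union>(n, N, c)\<in>I. C1_cell n N c)"
    proof
      fix f assume f: "f \<in> U"
      then obtain e where e: "e > 0" "\<And>g. g \<in> C1 \<Longrightarrow> c1_dist f g < e \<Longrightarrow> g \<in> U"
        using U by blast
      obtain n where "inverse (real (Suc n)) < e / 7" using reals_Archimedean[of "e / 7"] e by auto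
      then have n: "7 / real (Suc n) < e" by (simp add: field_simps)
      obtain N c where c: "f \<in> C1_cell n N c" using C1_cell_cover f U by blast
      have "C1_cell n N c \<subseteq> U"
        using C1_cell_small[OF c] e(2) n unfolding C1_cell_def
        by (smt (verit) mem_Collect_eq subsetI)
      then show "f \<in> (\<Union>(n, N, c)\<in>I. C1_cell n N c)" using c unfolding I_def by auto
    qed
    then have "U = (\<Union>(n, N, c)\<in>I. C1_cell n N c)" unfolding I_def by auto
    also have "\<dots> \<in> sets ?R"
      by (intro sets.countable_UN') (auto simp: C1_cell_measurable)
    finally show ?thesis .
  qed
  then show "sets c1_borel \<subseteq> sets ?R"
    unfolding c1_borel_def sets_measure_of[OF O]
    by (metis (no_types, lifting) sets.sigma_sets_subset space_C1_trace subsetI)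
  have eval: "(\<lambda>g. g t) \<in> borel_measurable c1_borel" for t
  proof (rule borel_measurableI)
    fix S :: "real set" assume S: "open S"
    have "(\<lambda>g. g t) -` S \<inter> C1 \<in> ?O"
    proof safe
      fix f assume f: "f \<in> C1" "f t \<in> S"
      then obtain e where e: "e > 0" "\<And>y. dist y (f t) < e \<Longrightarrow> y \<in> S"
        using S unfolding open_dist by blast
      have "g t \<in> S" if "g \<in> C1" "c1_dist f g < e" for g
        using e(2)[of "g t"] c1_dist_ge[OF f(1) that(1), of t] that(2)
        by (simp add: dist_real_def abs_minus_commute)
      then show "\<exists>e>0. \<forall>g\<in>C1. c1_dist f g < e \<longrightarrow> g \<in> (\<lambda>g. g t) -` S \<inter> C1"
        using e(1) by blast
    qed
    then show "(\<lambda>g. g t) -` S \<inter> space c1_borel \<in> sets c1_borel"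
      unfolding c1_borel_def sets_measure_of[OF O] space_measure_of[OF O] by blast
  qed
  \<comment> \<open>Measurability of the inclusion into the product space says that traces of
    product-measurable sets are Borel.\<close>
  have "(\<lambda>g. g) \<in> measurable c1_borel fun_borel"
    by (rule measurable_PiM_single') (auto simp: eval)
  moreover have "space c1_borel = C1" unfolding c1_borel_def by (rule space_measure_of[OF O])
  ultimately show "sets ?R \<subseteq> sets c1_borel"
    unfolding sets_restrict_space by (auto dest: measurable_sets simp: Int_commute)
qed


lemma space_c1_borel: "space c1_borel = C1"
  using sets_eq_imp_space_eq[OF sets_c1_borel] space_C1_trace by simp

text \<open>The same argument with products of two cells. Both factors use the same precision
  \<open>n\<close>, so the sum of the two distances is at most 14/(n+1).\<close>

lemma sets_c1_pair_borel:
  "sets c1_pair_borel = sets (restrict_space (fun_borel \<Otimes>\<^sub>M fun_borel) (C1 \<times> C1))"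
proof (rule antisym)
  let ?P = "fun_borel \<Otimes>\<^sub>M fun_borel"
  let ?R = "restrict_space ?P (C1 \<times> C1)"
  let ?O = "{U. U \<subseteq> C1 \<times> C1 \<and> (\<forall>p\<in>U. \<exists>e>0. \<forall>q\<in>C1 \<times> C1.
        c1_dist (fst p) (fst q) + c1_dist (snd p) (snd q) < e \<longrightarrow> q \<in> U)}"
  have O: "?O \<subseteq> Pow (C1 \<times> C1)" by blast
  have cell: "C1_cell n N c \<times> C1_cell n' N' c' \<in> sets ?R" for n N c n' N' c'
  proof -
    obtain A where A: "A \<in> sets fun_borel" "C1_cell n N c = C1 \<inter> A"
      using C1_cell_measurable[of n N c] unfolding sets_restrict_space by (elim imageE)
    obtain B where B: "B \<in> sets fun_borel" "C1_cell n' N' c' = C1 \<inter> B"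
      using C1_cell_measurable[of n' N' c'] unfolding sets_restrict_space by (elim imageE)
    show ?thesis
      unfolding sets_restrict_space A B Times_Int_Times[symmetric]
      by (intro imageI pair_measureI A B)
  qed
  have "U \<in> sets ?R" if U: "U \<in> ?O" for U
  proof -
    define K where "K = (\<lambda>(n, N, c, N', c'). C1_cell n N c \<times> C1_cell n N' c')"
    define I where "I = {i. K i \<subseteq> U}"
    have "U \<subseteq> (\<Union>i\<in>I. K i)"
    proof
      fix p assume p: "p \<in> U"
      then obtain e where e: "e > 0" "\<And>q. q \<in> C1 \<times> C1 \<Longrightarrow>
          c1_dist (fst p) (fst q) + c1_dist (snd p) (snd q) < e \<Longrightarrow> q \<in> U"
        using U by blast
      obtain n where "inverse (real (Suc n)) < e / 14"
        using reals_Archimedean[of "e / 14"] e by auto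
      then have n: "7 / real (Suc n) + 7 / real (Suc n) < e" by (simp add: field_simps flip: add_divide_distrib)
      have "fst p \<in> C1" "snd p \<in> C1" using p U by auto
      then obtain N c N' c' where c: "fst p \<in> C1_cell n N c" "snd p \<in> C1_cell n N' c'"
        using C1_cell_cover by metis
      have "K (n, N, c, N', c') \<subseteq> U"
      proof
        fix q assume "q \<in> K (n, N, c, N', c')"
        then have q: "q \<in> C1_cell n N c \<times> C1_cell n N' c'" by (simp add: K_def)
        then have "c1_dist (fst p) (fst q) \<le> 7 / real (Suc n)"
          "c1_dist (snd p) (snd q) \<le> 7 / real (Suc n)"
          using c by (auto intro!: C1_cell_small simp del: of_nat_Suc)
        moreover have "q \<in> C1 \<times> C1" using q unfolding C1_cell_def by auto
        ultimately show "q \<in> U" using n by (intro e(2)) linarith+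
      qed
      then show "p \<in> (\<Union>i\<in>I. K i)"
        unfolding I_def using c
        by (intro UN_I[of "(n, N, c, N', c')"]) (auto simp: K_def mem_Times_iff)
    qed
    then have "U = (\<Union>i\<in>I. K i)"
      unfolding I_def by blast
    also have "\<dots> \<in> sets ?R"
      by (intro sets.countable_UN') (auto simp: cell K_def)
    finally show ?thesis .
  qed
  moreover have "space ?R = C1 \<times> C1"
    by (simp add: space_restrict_space space_pair_measure space_PiM)
  ultimately show "sets c1_pair_borel \<subseteq> sets ?R"
    unfolding c1_pair_borel_def sets_measure_of[OF O]
    by (metis (no_types, lifting) sets.sigma_sets_subset subsetI)
  have space: "space c1_pair_borel = C1 \<times> C1"
    unfolding c1_pair_borel_def by (rule space_measure_of[OF O])
  have nonneg: "c1_dist f g \<ge> 0" if "f \<in> C1" "g \<in> C1" for f g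
    using c1_dist_ge[OF that, of 0] by linarith
  \<comment> \<open>Treats \<open>fst\<close> and \<open>snd\<close> at once: a 1-Lipschitz map into
    \<open>C1\<close> followed by evaluation at \<open>t\<close> is continuous.\<close>
  have coordinate: "(\<lambda>p. \<pi> p t) \<in> borel_measurable c1_pair_borel"
    if \<pi>: "\<And>p. p \<in> C1 \<times> C1 \<Longrightarrow> \<pi> p \<in> C1"
      "\<And>p q. p \<in> C1 \<times> C1 \<Longrightarrow> q \<in> C1 \<times> C1 \<Longrightarrow>
        c1_dist (\<pi> p) (\<pi> q) \<le> c1_dist (fst p) (fst q) + c1_dist (snd p) (snd q)"
    for \<pi> :: "(real \<Rightarrow> real) \<times> (real \<Rightarrow> real) \<Rightarrow> real \<Rightarrow> real" and t
  proof (rule borel_measurableI)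
    fix S :: "real set" assume S: "open S"
    have "(\<lambda>p. \<pi> p t) -` S \<inter> C1 \<times> C1 \<in> ?O"
    proof (intro CollectI conjI ballI)
      fix p assume "p \<in> (\<lambda>p. \<pi> p t) -` S \<inter> C1 \<times> C1"
      then have p: "p \<in> C1 \<times> C1" "\<pi> p t \<in> S" by auto
      then obtain e where e: "e > 0" "\<And>y. dist y (\<pi> p t) < e \<Longrightarrow> y \<in> S"
        using S unfolding open_dist by blast
      have "\<pi> q t \<in> S"
        if "q \<in> C1 \<times> C1" "c1_dist (fst p) (fst q) + c1_dist (snd p) (snd q) < e" for q
        using e(2)[of "\<pi> q t"] c1_dist_ge[OF \<pi>(1)[OF p(1)] \<pi>(1)[OF that(1)], of t]
          \<pi>(2)[OF p(1) that(1)] that(2)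
        by (simp add: dist_real_def abs_minus_commute)
      then show "\<exists>e>0. \<forall>q\<in>C1 \<times> C1. c1_dist (fst p) (fst q) + c1_dist (snd p) (snd q) < e
          \<longrightarrow> q \<in> (\<lambda>p. \<pi> p t) -` S \<inter> C1 \<times> C1"
        using e(1) by blast
    qed blast
    then show "(\<lambda>p. \<pi> p t) -` S \<inter> space c1_pair_borel \<in> sets c1_pair_borel"
      unfolding c1_pair_borel_def sets_measure_of[OF O] space_measure_of[OF O] by blast
  qed
  have "(\<lambda>p. fst p t) \<in> borel_measurable c1_pair_borel" for t
    by (rule coordinate) (auto simp: nonneg)
  moreover have "(\<lambda>p. snd p t) \<in> borel_measurable c1_pair_borel" for t
    by (rule coordinate) (auto simp: nonneg)
  ultimately have "(\<lambda>p. (\<lambda>t. fst p t, \<lambda>t. snd p t)) \<in> measurable c1_pair_borel ?P"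
    by (intro measurable_Pair measurable_PiM_single') auto
  then show "sets ?R \<subseteq> sets c1_pair_borel"
    unfolding sets_restrict_space using space by (auto dest: measurable_sets simp: Int_commute)
qed

section \<open>Measurability of random \<open>C1\<close> functions, of their values and of their
  derivatives\<close>

lemma measurable_c1_borelI:
  assumes "\<And>\<omega>. \<omega> \<in> space M \<Longrightarrow> F \<omega> \<in> C1"
    and "\<And>t. t \<in> {0..1} \<Longrightarrow> (\<lambda>\<omega>. F \<omega> t) \<in> borel_measurable M"
  shows "F \<in> measurable M c1_borel"
proof -
  have "(\<lambda>\<omega>. F \<omega> t) \<in> borel_measurable M" for t
  proof (cases "t \<in> {0..1}")
    case False
    then have "(\<lambda>\<omega>. F \<omega> t) \<in> borel_measurable M \<longleftrightarrow> (\<lambda>\<omega>. 0::real) \<in> borel_measurable M"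
      by (intro measurable_cong) (use assms(1) C1_outside in blast)
    then show ?thesis by simp
  qed (rule assms(2))
  then have "(\<lambda>\<omega> t. F \<omega> t) \<in> measurable M fun_borel"
    by (intro measurable_PiM_single') auto
  then show ?thesis
    unfolding measurable_cong_sets[OF refl sets_c1_borel]
    using assms(1) by (intro measurable_restrict_space2) auto
qed

lemma measurable_c1_pair_borelI:
  assumes "F \<in> measurable M c1_borel" "H \<in> measurable M c1_borel"
  shows "(\<lambda>\<omega>. (F \<omega>, H \<omega>)) \<in> measurable M c1_pair_borel"
  using assms
  unfolding measurable_cong_sets[OF refl sets_c1_borel] measurable_cong_sets[OF refl sets_c1_pair_borel]
  by (auto simp: measurable_restrict_space2_iff)

lemma measurable_c1_pair_borel_fst: "fst \<in> measurable c1_pair_borel c1_borel"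
  unfolding measurable_cong_sets[OF sets_c1_pair_borel sets_c1_borel]
  by (intro measurable_restrict_space2 measurable_restrict_space1 measurable_fst)
     (auto simp: space_restrict_space)

lemma measurable_c1_pair_borel_snd: "snd \<in> measurable c1_pair_borel c1_borel"
  unfolding measurable_cong_sets[OF sets_c1_pair_borel sets_c1_borel]
  by (intro measurable_restrict_space2 measurable_restrict_space1 measurable_snd)
     (auto simp: space_restrict_space)

lemma measurable_c1_borel_C1: "F \<in> measurable M c1_borel \<Longrightarrow> \<omega> \<in> space M \<Longrightarrow> F \<omega> \<in> C1"
  using measurable_space space_c1_borel by metis

lemma measurable_c1_borel_at:
  assumes "F \<in> measurable M c1_borel"
  shows "(\<lambda>\<omega>. F \<omega> t) \<in> borel_measurable M"
proof -
  have "(\<lambda>g. g t) \<in> borel_measurable c1_borel"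
    using measurable_C1_eval measurable_cong_sets[OF sets_c1_borel refl] by blast
  from measurable_compose[OF assms this] show ?thesis .
qed

text \<open>Rounding the random point \<open>s\<close> to the grid leaves countably many values,
  each handled by evaluation at a fixed point; path continuity then gives the limit. Off [0,1] the
  value is 0.\<close>

lemma measurable_c1_borel_eval:
  assumes F: "F \<in> measurable M c1_borel" and s[measurable]: "s \<in> borel_measurable M"
  shows "(\<lambda>\<omega>. F \<omega> (s \<omega>)) \<in> borel_measurable M"
proof -
  note measurable_c1_borel_at[OF F, measurable]
  have "(\<lambda>\<omega>. F \<omega> (real_of_int i / real (Suc n))) \<in> borel_measurable M" for i n
    by measurable
  then have "(\<lambda>\<omega>. F \<omega> (real_of_int \<lfloor>real (Suc n) * s \<omega>\<rfloor> / real (Suc n))) \<in> borel_measurable M" for n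
    by (rule measurable_compose_countable[where
        f = "\<lambda>i \<omega>. F \<omega> (real_of_int i / real (Suc n))"]) measurable
  then have g[measurable]: "(\<lambda>\<omega>. F \<omega> (grid n (s \<omega>))) \<in> borel_measurable M" for n
    unfolding grid_def .
  have "(\<lambda>\<omega>. if s \<omega> \<in> {0..1} then F \<omega> (s \<omega>) else 0) \<in> borel_measurable M"
  proof (rule borel_measurable_LIMSEQ_real)
    fix \<omega> assume "\<omega> \<in> space M"
    then have "F \<omega> \<in> C1" by (rule measurable_c1_borel_C1[OF F])
    then show "(\<lambda>n. if s \<omega> \<in> {0..1} then F \<omega> (grid n (s \<omega>)) else 0)
        \<longlonglongrightarrow> (if s \<omega> \<in> {0..1} then F \<omega> (s \<omega>) else 0)"
      using continuous_on_grid[OF C1_continuous] by auto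
  qed measurable
  moreover have "F \<omega> (s \<omega>) = (if s \<omega> \<in> {0..1} then F \<omega> (s \<omega>) else 0)" if "\<omega> \<in> space M" for \<omega>
    using measurable_c1_borel_C1[OF F that] C1_outside by auto
  ultimately show ?thesis by (simp cong: measurable_cong)
qed

lemma measurable_c1_borel_deriv:
  assumes F: "F \<in> measurable M c1_borel" and s[measurable]: "s \<in> borel_measurable M"
  shows "(\<lambda>\<omega>. if s \<omega> \<in> {0..1} then dC1 (F \<omega>) (s \<omega>) else 0) \<in> borel_measurable M"
proof (rule borel_measurable_LIMSEQ_real)
  \<comment> \<open>The increment is a measurable function of \<open>s\<close> that keeps the
    shifted point in [0,1]: it goes right when \<open>s\<close> is below 1, and left at the endpoint
    1.\<close>
  let ?d = "\<lambda>n \<omega>. if s \<omega> < 1 then (1 - s \<omega>) / real (Suc n) else - 1 / real (Suc n)"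
  fix \<omega> assume "\<omega> \<in> space M"
  then have C1: "F \<omega> \<in> C1" by (rule measurable_c1_borel_C1[OF F])
  show "(\<lambda>n. if s \<omega> \<in> {0..1} then (F \<omega> (s \<omega> + ?d n \<omega>) - F \<omega> (s \<omega>)) / ?d n \<omega> else 0)
    \<longlonglongrightarrow> (if s \<omega> \<in> {0..1} then dC1 (F \<omega>) (s \<omega>) else 0)"
  proof (cases "s \<omega> \<in> {0..1}")
    case True
    have "s \<omega> + ?d n \<omega> \<in> {0..1} - {s \<omega>}" for n
    proof (cases "s \<omega> < 1")
      case less: True
      have "0 < (1 - s \<omega>) / real (Suc n)" using less by simp
      moreover have "(1 - s \<omega>) / real (Suc n) \<le> 1 - s \<omega>"
        using less divide_left_mono[of 1 "real (Suc n)" "1 - s \<omega>"] by simp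
      ultimately show ?thesis using True less by auto
    next
      case False
      then show ?thesis using True by (auto simp: field_simps)
    qed
    moreover have "(\<lambda>n. s \<omega> + ?d n \<omega>) \<longlonglongrightarrow> s \<omega>"
    proof -
      have "(\<lambda>n. s \<omega> + c * inverse (real (Suc n))) \<longlonglongrightarrow> s \<omega> + c * 0" for c
        by (intro tendsto_intros LIMSEQ_inverse_real_of_nat)
      from this[of "1 - s \<omega>"] this[of "- 1"] show ?thesis
        by (cases "s \<omega> < 1") (auto simp: divide_inverse)
    qed
    ultimately have "(\<lambda>n. (F \<omega> (s \<omega> + ?d n \<omega>) - F \<omega> (s \<omega>)) / (s \<omega> + ?d n \<omega> - s \<omega>))
        \<longlonglongrightarrow> dC1 (F \<omega>) (s \<omega>)"
      by (rule difference_quotient_tendsto[OF C1_has_derivative[OF C1 True]])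
    then show ?thesis using True by simp
  next
    case False
    show ?thesis unfolding if_not_P[OF False] by (rule tendsto_const)
  qed
next
  fix n
  note measurable_c1_borel_eval[OF F, measurable]
  show "(\<lambda>\<omega>. if s \<omega> \<in> {0..1} then (F \<omega> (s \<omega> + (if s \<omega> < 1 then (1 - s \<omega>) / real (Suc n)
      else - 1 / real (Suc n))) - F \<omega> (s \<omega>)) /
      (if s \<omega> < 1 then (1 - s \<omega>) / real (Suc n) else - 1 / real (Suc n)) else 0)
    \<in> borel_measurable M"
    by measurable
qed

text \<open>A positive continuous derivative on a compact interval has a positive minimum, hence a
  lower bound 1/(n+1), which can be tested at rational points. Being a good warping thus becomes a
  countable condition.\<close>

lemma good_warp_iff_rational:
  assumes "h \<in> C1"
  shows "good_warp h \<longleftrightarrow> h 0 = 0 \<and> h 1 = 1 \<and>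
    (\<exists>n. \<forall>t\<in>\<rat> \<inter> {0..1}. 1 / real (Suc n) \<le> dC1 h t)"
proof -
  have "\<exists>n. \<forall>t\<in>\<rat> \<inter> {0..1}. 1 / real (Suc n) \<le> dC1 h t" if "\<forall>t\<in>{0..1}. dC1 h t > 0"
  proof -
    obtain t0 where t0: "t0 \<in> {0..1}" "\<forall>t\<in>{0..1}. dC1 h t0 \<le> dC1 h t"
      using continuous_attains_inf[OF _ _ C1_continuous_deriv[OF assms]] by auto
    have "dC1 h t0 > 0" using that t0(1) by blast
    then obtain n where "1 / real (Suc n) < dC1 h t0"
      using reals_Archimedean unfolding inverse_eq_divide by blast
    then show ?thesis using t0(2) by (meson IntD2 less_eq_real_def order_trans)
  qed
  moreover have "dC1 h t > 0"
    if n: "\<forall>t\<in>\<rat> \<inter> {0..1}. 1 / real (Suc n) \<le> dC1 h t" and t: "t \<in> {0..1}" for n t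
  proof -
    have "- dC1 h t \<le> - (1 / real (Suc n))"
      by (rule bound_from_rationals[OF _ _ t])
         (use n in \<open>auto intro!: continuous_intros C1_continuous_deriv assms\<close>)
    moreover have "1 / real (Suc n) > 0" by simp
    ultimately show ?thesis by linarith
  qed
  ultimately show ?thesis unfolding good_warp_def using assms by blast
qed

lemma measurable_good_warp:
  assumes H: "H \<in> measurable M c1_borel"
  shows "Measurable.pred M (\<lambda>\<omega>. good_warp (H \<omega>))"
proof -
  note measurable_c1_borel_at[OF H, measurable]
  have "countable (\<rat> \<inter> {0..1::real})" by (simp add: countable_rat)
  moreover have "Measurable.pred M (\<lambda>\<omega>. 1 / real (Suc n) \<le> dC1 (H \<omega>) t)"
    if "t \<in> \<rat> \<inter> {0..1}" for t n
  proof -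
    have [measurable]: "(\<lambda>\<omega>. dC1 (H \<omega>) t) \<in> borel_measurable M"
      using measurable_c1_borel_deriv[OF H, of "\<lambda>_. t"] that by simp
    show ?thesis by measurable
  qed
  ultimately have [measurable]:
    "Measurable.pred M (\<lambda>\<omega>. \<forall>t\<in>\<rat> \<inter> {0..1}. 1 / real (Suc n) \<le> dC1 (H \<omega>) t)" for n
    by (rule pred_countable_Ball)
  have "Measurable.pred M (\<lambda>\<omega>. H \<omega> 0 = 0 \<and> H \<omega> 1 = 1 \<and>
    (\<exists>n. \<forall>t\<in>\<rat> \<inter> {0..1}. 1 / real (Suc n) \<le> dC1 (H \<omega>) t))"
    by measurable
  then show ?thesis
    by (rule measurable_cong[THEN iffD1, rotated])
       (metis good_warp_iff_rational measurable_c1_borel_C1[OF H])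
qed

section \<open>Total variation and its normalised inverse as measurable functionals\<close>

text \<open>The variation of \<open>g\<close> on [0,t], as an integral over the whole line with the
  cut-offs inside the integrand. The inner cut-off matches \<open>measurable_c1_borel_deriv\<close>,
  which gives joint measurability in the path and \<open>u\<close>.\<close>

definition tvar :: "(real \<Rightarrow> real) \<Rightarrow> real \<Rightarrow> real" where
  "tvar g t = (\<integral>u. (if u \<le> t then \<bar>if u \<in> {0..1} then dC1 g u else 0\<bar> else 0) \<partial>lborel)"

text \<open>The inverse of the normalised variation, written as the length of a sublevel set so that its
  measurability in \<open>g\<close> follows from Fubini's theorem.\<close>

definition tvar_inv :: "(real \<Rightarrow> real) \<Rightarrow> real \<Rightarrow> real" where
  "tvar_inv g y = (\<integral>s. (if s \<in> {0..1} \<and> tvar g s < y * tvar g 1 then 1 else 0) \<partial>lborel)"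

text \<open>The endpoint \<open>t\<close> may be random because in \<open>tvar_inv\<close> it is
  itself the integration variable, a coordinate of the product with \<open>lborel\<close>.\<close>

lemma measurable_tvar:
  assumes F[measurable]: "F \<in> measurable M c1_borel" and t[measurable]: "t \<in> borel_measurable M"
  shows "(\<lambda>\<omega>. tvar (F \<omega>) (t \<omega>)) \<in> borel_measurable M"
proof -
  have [measurable]: "(\<lambda>p. if snd p \<in> {0..1} then dC1 (F (fst p)) (snd p) else 0)
      \<in> borel_measurable (M \<Otimes>\<^sub>M lborel)"
    by (rule measurable_c1_borel_deriv) measurable
  show ?thesis
    unfolding tvar_def
    by (rule lborel.borel_measurable_lebesgue_integral) (simp add: case_prod_beta)
qed

lemma measurable_tvar_inv:
  assumes F[measurable]: "F \<in> measurable M c1_borel"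
  shows "(\<lambda>\<omega>. tvar_inv (F \<omega>) y) \<in> borel_measurable M"
proof -
  have [measurable]: "(\<lambda>p. tvar (F (fst p)) (snd p)) \<in> borel_measurable (M \<Otimes>\<^sub>M lborel)"
    "(\<lambda>p. tvar (F (fst p)) 1) \<in> borel_measurable (M \<Otimes>\<^sub>M lborel)"
    by (rule measurable_tvar; measurable)+
  show ?thesis
    unfolding tvar_inv_def
    by (rule lborel.borel_measurable_lebesgue_integral) (simp add: case_prod_beta)
qed

lemma tvar_eq_integral:
  assumes "g \<in> C1" "t \<in> {0..1}"
  shows "tvar g t = integral {0..t} (\<lambda>u. \<bar>dC1 g u\<bar>)"
proof -
  have "continuous_on {0..t} (\<lambda>u. \<bar>dC1 g u\<bar>)"
    using assms(2)
    by (intro continuous_intros continuous_on_subset[OF C1_continuous_deriv[OF assms(1)]]) auto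
  then have "(LINT u:{0..t}|lborel. \<bar>dC1 g u\<bar>) = integral {0..t} (\<lambda>u. \<bar>dC1 g u\<bar>)"
    by (intro set_borel_integral_eq_integral(2) borel_integrable_atLeastAtMost')
  moreover have "tvar g t = (LINT u:{0..t}|lborel. \<bar>dC1 g u\<bar>)"
    unfolding tvar_def set_lebesgue_integral_def using assms(2)
    by (intro Bochner_Integration.integral_cong) (auto simp: indicator_def)
  ultimately show ?thesis by simp
qed

section \<open>Good warpings as increasing \<open>C1\<close> bijections of [0,1]\<close>

context
  fixes h :: "real \<Rightarrow> real"
  assumes warp: "good_warp h"
begin

lemma good_warp_C1: "h \<in> C1"
  using warp unfolding good_warp_def by blast

lemma good_warp_less:
  assumes "0 \<le> s" "s < t" "t \<le> 1"
  shows "h s < h t"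
proof (rule DERIV_pos_imp_increasing_open[OF assms(2)])
  fix x assume x: "s < x" "x < t"
  then have "x \<in> {0..1}" using assms by auto
  with C1_has_derivative[OF good_warp_C1 this] show "\<exists>y. DERIV h x :> y \<and> 0 < y"
    using warp x assms unfolding good_warp_def by (auto simp: at_within_Icc_at)
next
  show "continuous_on {s..t} h"
    using assms by (intro continuous_on_subset[OF C1_continuous[OF good_warp_C1]]) auto
qed

lemma good_warp_less_iff: "s \<in> {0..1} \<Longrightarrow> t \<in> {0..1} \<Longrightarrow> h s < h t \<longleftrightarrow> s < t"
  using good_warp_less[of s t] good_warp_less[of t s] by (cases s t rule: linorder_cases) auto

lemma good_warp_in_unit: "t \<in> {0..1} \<Longrightarrow> h t \<in> {0..1}"
  using good_warp_less[of 0 t] good_warp_less[of t 1] warp unfolding good_warp_def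
  by (cases "t = 0"; cases "t = 1") auto

text \<open>The intermediate value theorem gives a preimage and strict monotonicity its uniqueness,
  so the description in \<open>warp_inv\<close> is well defined.\<close>

lemma good_warp_inv:
  assumes "u \<in> {0..1}"
  shows "warp_inv h u \<in> {0..1}" "h (warp_inv h u) = u"
proof -
  obtain s where s: "s \<in> {0..1}" "h s = u"
    using IVT'[OF _ _ _ C1_continuous[OF good_warp_C1], of u] warp assms
    unfolding good_warp_def by auto
  have "warp_inv h u \<in> {0..1} \<and> h (warp_inv h u) = u"
    unfolding warp_inv_def
  proof (rule theI[where P = "\<lambda>s. s \<in> {0..1} \<and> h s = u"])
    fix s' assume "s' \<in> {0..1} \<and> h s' = u"
    then show "s' = s"
      using s good_warp_less_iff[of s s'] good_warp_less_iff[of s' s] by auto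
  qed (use s in blast)
  then show "warp_inv h u \<in> {0..1}" "h (warp_inv h u) = u" by auto
qed

lemma warp_comp_eq:
  "warp_comp f h = (\<lambda>t. if t \<in> {0..1} then f (h t) else 0)"
  using warp by (simp add: warp_comp_def)

text \<open>The values of \<open>h\<close> stay in [0,1], so the derivative of \<open>f\<close>
  within the image of \<open>h\<close> is enough for the chain rule, also at the endpoints.\<close>

lemma warp_comp_has_derivative:
  assumes "f \<in> C1" "t \<in> {0..1}"
  shows "(warp_comp f h has_real_derivative dC1 f (h t) * dC1 h t) (at t within {0..1})"
proof (rule has_field_derivative_transform_within[OF _ zero_less_one assms(2)])
  have "(f has_real_derivative dC1 f (h t)) (at (h t) within h ` {0..1})"
    by (rule DERIV_subset[OF C1_has_derivative[OF assms(1)]])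
       (use assms(2) in \<open>auto intro: good_warp_in_unit simp del: atLeastAtMost_iff\<close>)
  from DERIV_image_chain[OF this C1_has_derivative[OF good_warp_C1 assms(2)]]
  show "((f \<circ> h) has_real_derivative dC1 f (h t) * dC1 h t) (at t within {0..1})" .
qed (simp add: warp_comp_eq)

lemma good_warp_comp_C1:
  assumes "f \<in> C1"
  shows "warp_comp f h \<in> C1"
proof (rule C1I[OF _ warp_comp_has_derivative[OF assms]])
  have "continuous_on {0..1} (\<lambda>t. dC1 f (h t))"
    by (rule continuous_on_compose2[OF C1_continuous_deriv[OF assms]
          C1_continuous[OF good_warp_C1]])
       (intro image_subsetI good_warp_in_unit)
  then show "continuous_on {0..1} (\<lambda>t. dC1 f (h t) * dC1 h t)"
    by (intro continuous_intros C1_continuous_deriv good_warp_C1)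
qed (auto simp: warp_comp_eq)

end

section \<open>The normalised variation \<open>G\<close> of a profile and its effect under
  warping\<close>

definition rel_tvar :: "(real \<Rightarrow> real) \<Rightarrow> real \<Rightarrow> real" where
  "rel_tvar \<xi>' u = integral {0..u} (\<lambda>x. \<bar>\<xi>' x\<bar>) / integral {0..1} (\<lambda>x. \<bar>\<xi>' x\<bar>)"

locale C1_profile =
  fixes \<xi> \<xi>' :: "real \<Rightarrow> real"
  assumes \<xi>'_cont: "continuous_on {0..1} \<xi>'"
    and \<xi>_deriv: "\<forall>t\<in>{0..1}. (\<xi> has_real_derivative \<xi>' t) (at t within {0..1})"
    and \<xi>'_zeros: "countable {t\<in>{0..1}. \<xi>' t = 0}"
begin

lemma \<xi>'_abs_cont: "continuous_on {0..1} (\<lambda>x. \<bar>\<xi>' x\<bar>)"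
  by (intro continuous_intros \<xi>'_cont)

text \<open>If the increment over [s,t] were 0, the continuous integrand would vanish on all of
  [s,t], an uncountable set of zeros of \<open>\<xi>'\<close>.\<close>

lemma integral_abs_strict_mono:
  assumes "0 \<le> s" "s < t" "t \<le> 1"
  shows "integral {0..s} (\<lambda>x. \<bar>\<xi>' x\<bar>) < integral {0..t} (\<lambda>x. \<bar>\<xi>' x\<bar>)"
proof -
  have cont': "continuous_on {a..b} (\<lambda>x. \<bar>\<xi>' x\<bar>)" if "0 \<le> a" "b \<le> 1" for a b
    using that by (intro continuous_on_subset[OF \<xi>'_abs_cont]) auto
  have "integral {s..t} (\<lambda>x. \<bar>\<xi>' x\<bar>) \<noteq> 0"
  proof
    assume "integral {s..t} (\<lambda>x. \<bar>\<xi>' x\<bar>) = 0"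
    then have "\<forall>x\<in>{s..t}. \<bar>\<xi>' x\<bar> = 0"
      using integral_eq_0_iff[OF cont' assms(2)] assms by auto
    then have "{s..t} \<subseteq> {t\<in>{0..1}. \<xi>' t = 0}" using assms by auto
    then have "countable {s..t}" using \<xi>'_zeros countable_subset by blast
    then show False using uncountable_closed_interval assms(2) by blast
  qed
  moreover have "integral {s..t} (\<lambda>x. \<bar>\<xi>' x\<bar>) \<ge> 0"
    by (intro integral_nonneg integrable_continuous_interval cont') (use assms in auto)
  moreover have "integral {0..s} (\<lambda>x. \<bar>\<xi>' x\<bar>) + integral {s..t} (\<lambda>x. \<bar>\<xi>' x\<bar>)
      = integral {0..t} (\<lambda>x. \<bar>\<xi>' x\<bar>)"
    using assms
    by (intro Henstock_Kurzweil_Integration.integral_combine integrable_continuous_interval cont') auto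
  ultimately show ?thesis by linarith
qed

lemma integral_abs_pos: "integral {0..1} (\<lambda>x. \<bar>\<xi>' x\<bar>) > 0"
  using integral_abs_strict_mono[of 0 1] by simp

lemma rel_tvar_less_iff:
  assumes "s \<in> {0..1}" "t \<in> {0..1}"
  shows "rel_tvar \<xi>' s < rel_tvar \<xi>' t \<longleftrightarrow> s < t"
proof -
  have "rel_tvar \<xi>' s < rel_tvar \<xi>' t" if "0 \<le> s" "s < t" "t \<le> 1" for s t
    unfolding rel_tvar_def
    by (intro divide_strict_right_mono integral_abs_strict_mono integral_abs_pos that)
  from this[of s t] this[of t s] assms show ?thesis
    by (cases s t rule: linorder_cases) auto
qed

lemma rel_tvar_0_1: "rel_tvar \<xi>' 0 = 0" "rel_tvar \<xi>' 1 = 1"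
  using integral_abs_pos by (auto simp: rel_tvar_def)

lemma rel_tvar_continuous: "continuous_on {0..1} (rel_tvar \<xi>')"
  unfolding rel_tvar_def
  by (intro continuous_intros indefinite_integral_continuous_1 integrable_continuous_interval \<xi>'_cont)
     (use integral_abs_pos in auto)

lemma rel_tvar_surj:
  assumes "y \<in> {0..1}"
  obtains u where "u \<in> {0..1}" "rel_tvar \<xi>' u = y"
  using IVT'[OF _ _ _ rel_tvar_continuous, of y] assms rel_tvar_0_1 by auto

lemma rel_tvar_inj: "inj_on (rel_tvar \<xi>') {0..1}"
proof (rule inj_onI)
  fix s t assume "s \<in> {0..1}" "t \<in> {0..1}" "rel_tvar \<xi>' s = rel_tvar \<xi>' t"
  then show "s = t" using rel_tvar_less_iff[of s t] rel_tvar_less_iff[of t s] by simp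
qed

lemma rel_tvar_image: "rel_tvar \<xi>' ` {0..1} = {0..1}"
proof
  show "rel_tvar \<xi>' ` {0..1} \<subseteq> {0..1}"
  proof (rule image_subsetI)
    fix u :: real assume "u \<in> {0..1}"
    then show "rel_tvar \<xi>' u \<in> {0..1}"
      using rel_tvar_less_iff[of u 0] rel_tvar_less_iff[of 1 u] rel_tvar_0_1 by auto
  qed
  show "{0..1} \<subseteq> rel_tvar \<xi>' ` {0..1}"
  proof
    fix y :: real assume "y \<in> {0..1}"
    then obtain u where "u \<in> {0..1}" "rel_tvar \<xi>' u = y" by (rule rel_tvar_surj)
    then show "y \<in> rel_tvar \<xi>' ` {0..1}" by blast
  qed
qed

lemma lin_fun_C1: "lin_fun a b \<xi> \<in> C1"
  and lin_fun_has_derivative: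
    "t \<in> {0..1} \<Longrightarrow> (lin_fun a b \<xi> has_real_derivative b * \<xi>' t) (at t within {0..1})"
proof -
  show D: "(lin_fun a b \<xi> has_real_derivative b * \<xi>' t) (at t within {0..1})"
    if t: "t \<in> {0..1}" for t
  proof (rule has_field_derivative_transform_within[OF _ zero_less_one t])
    show "((\<lambda>t. a + b * \<xi> t) has_real_derivative b * \<xi>' t) (at t within {0..1})"
      using \<xi>_deriv t by (auto intro!: derivative_eq_intros)
  qed (simp add: lin_fun_def)
  show "lin_fun a b \<xi> \<in> C1"
    by (rule C1I[OF _ D]) (auto intro!: continuous_intros \<xi>'_cont simp: lin_fun_def)
qed

context
  fixes h :: "real \<Rightarrow> real"
  assumes warp: "good_warp h"
begin

context
  fixes a b :: real and g
  assumes b: "b \<noteq> 0" and g: "g = warp_comp (lin_fun a b \<xi>) h"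
begin

text \<open>Since h' > 0, the absolute derivative of \<open>g\<close> is |b| |\<xi>'(h)| h', which
  is the derivative of |b| W(h), where W is the variation function of \<xi>. The fundamental theorem
  of calculus concludes, as h(0) = 0.\<close>

lemma tvar_warped:
  assumes t: "t \<in> {0..1}"
  shows "tvar g t = \<bar>b\<bar> * integral {0..h t} (\<lambda>x. \<bar>\<xi>' x\<bar>)"
proof -
  let ?W = "\<lambda>u. integral {0..u} (\<lambda>x. \<bar>\<xi>' x\<bar>)"
  have dg: "dC1 g x = b * \<xi>' (h x) * dC1 h x" if "x \<in> {0..1}" for x
  proof -
    have "dC1 (lin_fun a b \<xi>) (h x) = b * \<xi>' (h x)"
      by (intro dC1_eqI lin_fun_has_derivative good_warp_in_unit[OF warp that])
    with dC1_eqI[OF warp_comp_has_derivative[OF warp lin_fun_C1[of a b] that] that]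
    show ?thesis by (simp add: g)
  qed
  have "((\<lambda>x. \<bar>dC1 g x\<bar>) has_integral \<bar>b\<bar> * ?W (h t) - \<bar>b\<bar> * ?W (h 0)) {0..t}"
  proof (rule fundamental_theorem_of_calculus)
    fix x assume x: "x \<in> {0..t}"
    then have x1: "x \<in> {0..1}" using t by auto
    have "(?W has_real_derivative \<bar>\<xi>' (h x)\<bar>) (at (h x) within h ` {0..t})"
      by (rule DERIV_subset[OF integral_has_real_derivative[OF \<xi>'_abs_cont good_warp_in_unit[OF warp x1]]])
         (intro image_subsetI good_warp_in_unit[OF warp], use t in auto)
    moreover have "(h has_real_derivative dC1 h x) (at x within {0..t})"
      by (rule DERIV_subset[OF C1_has_derivative[OF good_warp_C1[OF warp] x1]]) (use t in auto)
    ultimately have "((?W \<circ> h) has_real_derivative \<bar>\<xi>' (h x)\<bar> * dC1 h x) (at x within {0..t})"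
      by (rule DERIV_image_chain)
    then have "((\<lambda>x. \<bar>b\<bar> * (?W \<circ> h) x) has_real_derivative \<bar>b\<bar> * (\<bar>\<xi>' (h x)\<bar> * dC1 h x)) (at x within {0..t})"
      by (rule DERIV_cmult)
    moreover have "\<bar>b\<bar> * (\<bar>\<xi>' (h x)\<bar> * dC1 h x) = \<bar>dC1 g x\<bar>"
      using dg[OF x1] x1 warp by (simp add: good_warp_def abs_mult less_imp_le)
    ultimately show "((\<lambda>x. \<bar>b\<bar> * ?W (h x)) has_vector_derivative \<bar>dC1 g x\<bar>) (at x within {0..t})"
      by (simp add: has_real_derivative_iff_has_vector_derivative)
  qed (use t in auto)
  moreover have "h 0 = 0" using warp by (simp add: good_warp_def)
  ultimately have "integral {0..t} (\<lambda>x. \<bar>dC1 g x\<bar>) = \<bar>b\<bar> * ?W (h t)"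
    by (simp add: integral_unique)
  moreover have "g \<in> C1" unfolding g by (intro good_warp_comp_C1 warp lin_fun_C1)
  ultimately show ?thesis using tvar_eq_integral t by simp
qed

lemma tvar_warped_total: "tvar g 1 = \<bar>b\<bar> * integral {0..1} (\<lambda>x. \<bar>\<xi>' x\<bar>)" "tvar g 1 > 0"
proof -
  show "tvar g 1 = \<bar>b\<bar> * integral {0..1} (\<lambda>x. \<bar>\<xi>' x\<bar>)"
    using tvar_warped[of 1] warp by (simp add: good_warp_def)
  then show "tvar g 1 > 0" using integral_abs_pos b by simp
qed

text \<open>The shift \<open>a\<close> disappears in the derivative and |b| in the quotient, so only
  the profile and the warping remain.\<close>

lemma tvar_ratio_warped:
  assumes "t \<in> {0..1}"
  shows "tvar g t / tvar g 1 = rel_tvar \<xi>' (h t)"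
  using tvar_warped[OF assms] tvar_warped_total b by (simp add: rel_tvar_def)

text \<open>As \<open>G\<close> and \<open>h\<close> are strictly increasing, the sublevel set
  defining \<open>tvar_inv\<close> is the half-open interval from 0 to h^-1(u), whose length is
  h^-1(u).\<close>

lemma tvar_inv_warped:
  assumes u: "u \<in> {0..1}"
  shows "tvar_inv g (rel_tvar \<xi>' u) = warp_inv h u"
proof -
  let ?w = "warp_inv h u"
  have "tvar g s < rel_tvar \<xi>' u * tvar g 1 \<longleftrightarrow> s < ?w" if s: "s \<in> {0..1}" for s
  proof -
    have "tvar g s < rel_tvar \<xi>' u * tvar g 1 \<longleftrightarrow> rel_tvar \<xi>' (h s) < rel_tvar \<xi>' u"
      unfolding tvar_ratio_warped[OF s, symmetric] using tvar_warped_total(2)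
      by (simp add: divide_less_eq)
    also have "\<dots> \<longleftrightarrow> h s < h ?w"
      using rel_tvar_less_iff[OF good_warp_in_unit[OF warp s] u] good_warp_inv(2)[OF warp u] by simp
    also have "\<dots> \<longleftrightarrow> s < ?w"
      by (rule good_warp_less_iff[OF warp s good_warp_inv(1)[OF warp u]])
    finally show ?thesis .
  qed
  then have "tvar_inv g (rel_tvar \<xi>' u) = (\<integral>s. indicator {0..<?w} s \<partial>lborel)"
    unfolding tvar_inv_def using good_warp_inv(1)[OF warp u]
    by (intro Bochner_Integration.integral_cong) (auto simp: indicator_def)
  also have "\<dots> = ?w" using good_warp_inv(1)[OF warp u] by simp
  finally show ?thesis .
qed

lemma lin_fun_eq_unwarped:
  assumes "u \<in> {0..1}"
  shows "lin_fun a b \<xi> u = g (warp_inv h u)"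
  using good_warp_inv[OF warp assms] by (simp add: g warp_comp_eq[OF warp])

end

end

end

section \<open>Measurability of the warped path\<close>

lemma warp_comp_C1:
  assumes "f \<in> C1"
  shows "warp_comp f h \<in> C1"
proof (cases "good_warp h")
  case True
  then show ?thesis using assms by (rule good_warp_comp_C1)
next
  case False
  moreover have "(\<lambda>_. 0) \<in> C1" by (rule C1I[of "\<lambda>_. 0"]) auto
  ultimately show ?thesis by (simp add: warp_comp_def)
qed

text \<open>For fixed \<open>t\<close> the composition is the random function \<open>F\<close>
  evaluated at the random point \<open>H \<omega> t\<close>, on a measurable event.\<close>

lemma measurable_warp_comp:
  assumes F: "F \<in> measurable M c1_borel" and H: "H \<in> measurable M c1_borel"
  shows "(\<lambda>\<omega>. warp_comp (F \<omega>) (H \<omega>)) \<in> measurable M c1_borel"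
proof (rule measurable_c1_borelI)
  fix t :: real assume t: "t \<in> {0..1}"
  note measurable_good_warp[OF H, measurable]
  have [measurable]: "(\<lambda>\<omega>. F \<omega> (H \<omega> t)) \<in> borel_measurable M"
    by (rule measurable_c1_borel_eval[OF F measurable_c1_borel_at[OF H]])
  have "(\<lambda>\<omega>. if good_warp (H \<omega>) then F \<omega> (H \<omega> t) else 0) \<in> borel_measurable M"
    by measurable
  moreover have "warp_comp (F \<omega>) (H \<omega>) t = (if good_warp (H \<omega>) then F \<omega> (H \<omega> t) else 0)" for \<omega>
    using t by (simp add: warp_comp_def)
  ultimately show "(\<lambda>\<omega>. warp_comp (F \<omega>) (H \<omega>) t) \<in> borel_measurable M" by simp
qed (intro warp_comp_C1 measurable_c1_borel_C1[OF F])

section \<open>A single random model and the recovery of \<open>(f, h)\<close> from the warped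
  path\<close>

locale warped_linear_model = prob_space M + C1_profile \<xi> \<xi>'
  for M :: "'a measure" and \<xi> \<xi>' :: "real \<Rightarrow> real" +
  fixes ash asc :: "'a \<Rightarrow> real" and h :: "'a \<Rightarrow> real \<Rightarrow> real"
  assumes ash[measurable]: "ash \<in> borel_measurable M"
    and asc[measurable]: "asc \<in> borel_measurable M"
    and asc_nz: "measure M {\<omega>\<in>space M. asc \<omega> = 0} = 0"
    and h: "h \<in> measurable M c1_borel"
    and h_warp: "AE \<omega> in M. good_warp (h \<omega>)"
    and h_mean: "\<forall>t\<in>{0..1}. (\<integral>\<omega>. warp_inv (h \<omega>) t \<partial>M) = t"
begin

abbreviation f :: "'a \<Rightarrow> real \<Rightarrow> real" where
  "f \<omega> \<equiv> lin_fun (ash \<omega>) (asc \<omega>) \<xi>"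

abbreviation warped :: "'a \<Rightarrow> real \<Rightarrow> real" where
  "warped \<omega> \<equiv> warp_comp (f \<omega>) (h \<omega>)"

lemma measurable_f: "f \<in> measurable M c1_borel"
  by (rule measurable_c1_borelI)
     (simp_all add: lin_fun_C1, simp add: lin_fun_def)

lemma measurable_warped: "warped \<in> measurable M c1_borel"
  by (rule measurable_warp_comp[OF measurable_f h])

lemma measurable_f_h: "(\<lambda>\<omega>. (f \<omega>, h \<omega>)) \<in> measurable M c1_pair_borel"
  by (rule measurable_c1_pair_borelI[OF measurable_f h])

lemma AE_regular: "AE \<omega> in M. good_warp (h \<omega>) \<and> asc \<omega> \<noteq> 0"
proof -
  have "AE \<omega> in M. asc \<omega> \<noteq> 0"
    by (rule AE_I[of _ _ "{\<omega>\<in>space M. asc \<omega> = 0}"]) (auto simp: emeasure_eq_measure asc_nz)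
  with h_warp show ?thesis by eventually_elim blast
qed

text \<open>The left side involves the model only through the law of \<open>warped\<close> and the
  level G(u), so this identity lets the law determine \<open>G\<close>. The point u = 0 is excluded
  because the mean there is 0.\<close>

lemma expectation_tvar_inv:
  assumes "u \<in> {0<..1}"
  shows "(\<integral>\<omega>. tvar_inv (warped \<omega>) (rel_tvar \<xi>' u) \<partial>M) = u"
proof -
  have mean: "(\<integral>\<omega>. warp_inv (h \<omega>) u \<partial>M) = u" using h_mean assms by auto
  \<comment> \<open>On the null event where \<open>h\<close> is not a warping, \<open>warp_inv\<close> is a junk value that need not be
    measurable; measurability is recovered from the integral being nonzero.\<close>
  then have "integrable M (\<lambda>\<omega>. warp_inv (h \<omega>) u)"
    using not_integrable_integral_eq assms by force
  then have "(\<lambda>\<omega>. warp_inv (h \<omega>) u) \<in> borel_measurable M" by auto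
  moreover have "AE \<omega> in M. tvar_inv (warped \<omega>) (rel_tvar \<xi>' u) = warp_inv (h \<omega>) u"
    using AE_regular
  proof eventually_elim
    case (elim \<omega>)
    then show ?case
      using assms by (intro tvar_inv_warped[OF _ _ refl]) auto
  qed
  ultimately have "(\<integral>\<omega>. tvar_inv (warped \<omega>) (rel_tvar \<xi>' u) \<partial>M) = (\<integral>\<omega>. warp_inv (h \<omega>) u \<partial>M)"
    by (intro integral_cong_AE measurable_tvar_inv measurable_warped)
  with mean show ?thesis by simp
qed

text \<open>The deterministic map from a path back to the pair. It depends on the profile only
  through \<open>G\<close> on [0,1]. Requiring the ratio to lie in [0,1] keeps the inverse of
  \<open>G\<close> on its domain and the map measurable for arbitrary paths.\<close>

definition unwarp :: "(real \<Rightarrow> real) \<Rightarrow> (real \<Rightarrow> real) \<times> (real \<Rightarrow> real)" where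
  "unwarp g =
    (\<lambda>t. if t \<in> {0..1} then g (tvar_inv g (rel_tvar \<xi>' t)) else 0,
     \<lambda>t. if t \<in> {0..1} \<and> tvar g t / tvar g 1 \<in> {0..1}
       then the_inv_into {0..1} (rel_tvar \<xi>') (tvar g t / tvar g 1) else 0)"

text \<open>Almost surely \<open>f\<close> is (f o h) o h^-1 with h^-1 = \<open>tvar_inv\<close> o
  G, and \<open>h\<close> is G^-1 applied to the normalised variation G o h.\<close>

lemma AE_unwarp: "AE \<omega> in M. unwarp (warped \<omega>) = (f \<omega>, h \<omega>)"
  using AE_regular AE_space
proof eventually_elim
  case (elim \<omega>)
  let ?G = "rel_tvar \<xi>'"
  have warp: "good_warp (h \<omega>)" and b: "asc \<omega> \<noteq> 0" using elim by auto
  have "(if t \<in> {0..1} then warped \<omega> (tvar_inv (warped \<omega>) (?G t)) else 0) = f \<omega> t" for t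
  proof (cases "t \<in> {0..1}")
    case True
    then show ?thesis
      using tvar_inv_warped[OF warp b refl True]
        lin_fun_eq_unwarped[OF warp b refl True] by simp
  qed (auto simp: lin_fun_def)
  moreover have "(if t \<in> {0..1} \<and> tvar (warped \<omega>) t / tvar (warped \<omega>) 1 \<in> {0..1}
       then the_inv_into {0..1} ?G (tvar (warped \<omega>) t / tvar (warped \<omega>) 1) else 0) = h \<omega> t" for t
  proof (cases "t \<in> {0..1}")
    case True
    have "h \<omega> t \<in> {0..1}" by (rule good_warp_in_unit[OF warp True])
    then have "the_inv_into {0..1} ?G (?G (h \<omega> t)) = h \<omega> t" "?G (h \<omega> t) \<in> {0..1}"
      using the_inv_into_f_f[OF rel_tvar_inj] rel_tvar_image by blast+
    then show ?thesis
      unfolding tvar_ratio_warped[OF warp b refl True] using True by presburger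
  next
    case False
    then show ?thesis using C1_outside[OF good_warp_C1[OF warp] False] by presburger
  qed
  ultimately show ?case unfolding unwarp_def by simp
qed

text \<open>The target is the plain product space, because for an arbitrary path in
  \<open>C1\<close> the two components need not be continuously differentiable.\<close>

lemma measurable_unwarp: "unwarp \<in> measurable c1_borel (fun_borel \<Otimes>\<^sub>M fun_borel)"
proof -
  let ?G = "rel_tvar \<xi>'"
  have id: "(\<lambda>g. g) \<in> measurable c1_borel c1_borel" by simp
  have [measurable]: "(\<lambda>g. tvar g t) \<in> borel_measurable c1_borel" for t
    by (rule measurable_tvar[OF id]) simp
  have [measurable]: "(\<lambda>g. g (tvar_inv g y)) \<in> borel_measurable c1_borel" for y
    by (rule measurable_c1_borel_eval[OF id measurable_tvar_inv[OF id]])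
  have "continuous_on (?G ` {0..1}) (the_inv_into {0..1} ?G)"
    by (rule continuous_on_inv[OF rel_tvar_continuous])
       (auto simp: the_inv_into_f_f[OF rel_tvar_inj])
  then have "continuous_on {0..1} (the_inv_into {0..1} ?G)"
    by (simp add: rel_tvar_image)
  then have inv: "(\<lambda>y. if y \<in> {0..1} then the_inv_into {0..1} ?G y else 0) \<in> borel_measurable borel"
    by (intro borel_measurable_continuous_on_if) auto
  have "(\<lambda>g. if tvar g t / tvar g 1 \<in> {0..1}
      then the_inv_into {0..1} ?G (tvar g t / tvar g 1) else 0) \<in> borel_measurable c1_borel" for t
    by (rule measurable_compose[OF _ inv]) measurable
  then have "(\<lambda>g. if t \<in> {0..1} \<and> tvar g t / tvar g 1 \<in> {0..1}
      then the_inv_into {0..1} ?G (tvar g t / tvar g 1) else 0) \<in> borel_measurable c1_borel" for t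
    by (cases "t \<in> {0..1}") (simp_all only: simp_thms if_False borel_measurable_const)
  moreover have "(\<lambda>g. if t \<in> {0..1} then g (tvar_inv g (?G t)) else 0)
      \<in> borel_measurable c1_borel" for t
    by measurable
  ultimately show ?thesis
    unfolding unwarp_def by (intro measurable_Pair measurable_PiM_single') auto
qed

lemma distr_f_h_eq_unwarp:
  "distr M (fun_borel \<Otimes>\<^sub>M fun_borel) (\<lambda>\<omega>. (f \<omega>, h \<omega>))
    = distr (distr M c1_borel warped) (fun_borel \<Otimes>\<^sub>M fun_borel) unwarp"
proof -
  have "(\<lambda>\<omega>. (f \<omega>, h \<omega>)) \<in> measurable M (fun_borel \<Otimes>\<^sub>M fun_borel)"
    using measurable_f_h unfolding measurable_cong_sets[OF refl sets_c1_pair_borel]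
    by (simp add: measurable_restrict_space2_iff)
  moreover have "(\<lambda>\<omega>. unwarp (warped \<omega>)) \<in> measurable M (fun_borel \<Otimes>\<^sub>M fun_borel)"
    by (rule measurable_compose[OF measurable_warped measurable_unwarp])
  ultimately have "distr M (fun_borel \<Otimes>\<^sub>M fun_borel) (\<lambda>\<omega>. unwarp (warped \<omega>))
    = distr M (fun_borel \<Otimes>\<^sub>M fun_borel) (\<lambda>\<omega>. (f \<omega>, h \<omega>))"
    using AE_unwarp by (intro distr_cong_AE) auto
  then show ?thesis
    by (simp add: distr_distr[OF measurable_unwarp measurable_warped] o_def)
qed

text \<open>The pair takes all its values in \<open>C1 \<times> C1\<close>, so passing between the
  trace and the full product space loses no mass.\<close>

lemma emeasure_distr_f_h:
  assumes "B \<in> sets (fun_borel \<Otimes>\<^sub>M fun_borel)"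
  shows "emeasure (distr M c1_pair_borel (\<lambda>\<omega>. (f \<omega>, h \<omega>))) ((C1 \<times> C1) \<inter> B)
    = emeasure (distr M (fun_borel \<Otimes>\<^sub>M fun_borel) (\<lambda>\<omega>. (f \<omega>, h \<omega>))) B"
proof -
  have "(\<lambda>\<omega>. (f \<omega>, h \<omega>)) \<in> measurable M (fun_borel \<Otimes>\<^sub>M fun_borel)"
    using measurable_f_h unfolding measurable_cong_sets[OF refl sets_c1_pair_borel]
    by (simp add: measurable_restrict_space2_iff)
  moreover have "(C1 \<times> C1) \<inter> B \<in> sets c1_pair_borel"
    unfolding sets_c1_pair_borel sets_restrict_space using assms by blast
  moreover have "(\<lambda>\<omega>. (f \<omega>, h \<omega>)) -` ((C1 \<times> C1) \<inter> B) \<inter> space M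
    = (\<lambda>\<omega>. (f \<omega>, h \<omega>)) -` B \<inter> space M"
    using measurable_c1_borel_C1[OF measurable_f] measurable_c1_borel_C1[OF h] by blast
  ultimately show ?thesis
    using assms by (simp add: emeasure_distr measurable_f_h)
qed

text \<open>Composition is a measurable functional of the pair, so the joint law determines the law
  of the warped path.\<close>

lemma distr_warped_eq:
  "distr M c1_borel warped
    = distr (distr M c1_pair_borel (\<lambda>\<omega>. (f \<omega>, h \<omega>))) c1_borel (\<lambda>p. warp_comp (fst p) (snd p))"
  by (subst distr_distr[OF measurable_warp_comp[OF measurable_c1_pair_borel_fst
          measurable_c1_pair_borel_snd] measurable_f_h]) (simp add: o_def)

end

section \<open>Identification of \<open>G\<close> from the law, and the equivalence of the two
  equalities in law\<close>

text \<open>Take \<open>v\<close> at which the second normalised variation reaches the level of the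
  first at \<open>u\<close>. At this common level the means of \<open>tvar_inv\<close> agree, being
  functionals of the same law, and they equal \<open>u\<close> and \<open>v\<close>.\<close>

lemma rel_tvar_eq_if_distr_eq:
  assumes "warped_linear_model M1 \<xi>1 \<xi>1' ash1 asc1 h1" "warped_linear_model M2 \<xi>2 \<xi>2' ash2 asc2 h2"
    and eq: "distr M1 c1_borel (\<lambda>\<omega>. warp_comp (lin_fun (ash1 \<omega>) (asc1 \<omega>) \<xi>1) (h1 \<omega>))
      = distr M2 c1_borel (\<lambda>\<omega>. warp_comp (lin_fun (ash2 \<omega>) (asc2 \<omega>) \<xi>2) (h2 \<omega>))"
    and u: "u \<in> {0..1}"
  shows "rel_tvar \<xi>1' u = rel_tvar \<xi>2' u"
proof -
  interpret m1: warped_linear_model M1 \<xi>1 \<xi>1' ash1 asc1 h1 by fact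
  interpret m2: warped_linear_model M2 \<xi>2 \<xi>2' ash2 asc2 h2 by fact
  show ?thesis
  proof (cases "u = 0")
    case True
    then show ?thesis using m1.rel_tvar_0_1(1) m2.rel_tvar_0_1(1) by simp
  next
    case False
    have id: "(\<lambda>g. g) \<in> measurable c1_borel c1_borel" by simp
    have same: "(\<integral>\<omega>. tvar_inv (m1.warped \<omega>) y \<partial>M1) = (\<integral>\<omega>. tvar_inv (m2.warped \<omega>) y \<partial>M2)" for y
      using integral_distr[OF m1.measurable_warped measurable_tvar_inv[OF id], of y]
        integral_distr[OF m2.measurable_warped measurable_tvar_inv[OF id], of y] eq by simp
    have "rel_tvar \<xi>1' u \<in> {0..1}" using m1.rel_tvar_image u by blast
    then obtain v where v: "v \<in> {0..1}" "rel_tvar \<xi>2' v = rel_tvar \<xi>1' u"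
      by (rule m2.rel_tvar_surj)
    have "rel_tvar \<xi>1' u > 0"
      using m1.rel_tvar_less_iff[of 0 u] m1.rel_tvar_0_1(1) u False by auto
    then have "v \<noteq> 0" using v(2) m2.rel_tvar_0_1(1) by auto
    then have "v = u"
      using m1.expectation_tvar_inv[of u] m2.expectation_tvar_inv[of v] same v u False by auto
    with v(2) show ?thesis by simp
  qed
qed

theorem theorem1:
  fixes M1 :: "'a measure" and M2 :: "'b measure"
    and \<xi>1 \<xi>1' \<xi>2 \<xi>2' :: "real \<Rightarrow> real"
    and ash1 asc1 :: "'a \<Rightarrow> real" and ash2 asc2 :: "'b \<Rightarrow> real"
    and h1 :: "'a \<Rightarrow> real \<Rightarrow> real" and h2 :: "'b \<Rightarrow> real \<Rightarrow> real"
  assumes "prob_space M1" and "prob_space M2"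
    and "continuous_on {0..1} \<xi>1'"
    and "\<forall>t\<in>{0..1}. (\<xi>1 has_real_derivative \<xi>1' t) (at t within {0..1})"
    and "countable {t\<in>{0..1}. \<xi>1' t = 0}"
    and "continuous_on {0..1} \<xi>2'"
    and "\<forall>t\<in>{0..1}. (\<xi>2 has_real_derivative \<xi>2' t) (at t within {0..1})"
    and "countable {t\<in>{0..1}. \<xi>2' t = 0}"
    and "ash1 \<in> borel_measurable M1" and "asc1 \<in> borel_measurable M1"
    and "ash2 \<in> borel_measurable M2" and "asc2 \<in> borel_measurable M2"
    and "measure M1 {\<omega>\<in>space M1. asc1 \<omega> = 0} = 0"
    and "measure M2 {\<omega>\<in>space M2. asc2 \<omega> = 0} = 0"
    and "h1 \<in> measurable M1 c1_borel" and "h2 \<in> measurable M2 c1_borel"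
    and "AE \<omega> in M1. good_warp (h1 \<omega>)"
    and "AE \<omega> in M2. good_warp (h2 \<omega>)"
    and "\<forall>t\<in>{0..1}. (\<integral>\<omega>. warp_inv (h1 \<omega>) t \<partial>M1) = t"
    and "\<forall>t\<in>{0..1}. (\<integral>\<omega>. warp_inv (h2 \<omega>) t \<partial>M2) = t"
  shows "distr M1 c1_borel (\<lambda>\<omega>. warp_comp (lin_fun (ash1 \<omega>) (asc1 \<omega>) \<xi>1) (h1 \<omega>))
           = distr M2 c1_borel (\<lambda>\<omega>. warp_comp (lin_fun (ash2 \<omega>) (asc2 \<omega>) \<xi>2) (h2 \<omega>))
     \<longleftrightarrow> distr M1 c1_pair_borel (\<lambda>\<omega>. (lin_fun (ash1 \<omega>) (asc1 \<omega>) \<xi>1, h1 \<omega>))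
           = distr M2 c1_pair_borel (\<lambda>\<omega>. (lin_fun (ash2 \<omega>) (asc2 \<omega>) \<xi>2, h2 \<omega>))"
proof -
  have model1: "warped_linear_model M1 \<xi>1 \<xi>1' ash1 asc1 h1"
    using assms unfolding warped_linear_model_def warped_linear_model_axioms_def C1_profile_def by blast
  have model2: "warped_linear_model M2 \<xi>2 \<xi>2' ash2 asc2 h2"
    using assms unfolding warped_linear_model_def warped_linear_model_axioms_def C1_profile_def by blast
  interpret m1: warped_linear_model M1 \<xi>1 \<xi>1' ash1 asc1 h1 by (rule model1)
  interpret m2: warped_linear_model M2 \<xi>2 \<xi>2' ash2 asc2 h2 by (rule model2)
  show ?thesis
  proof
    assume eq: "distr M1 c1_borel m1.warped = distr M2 c1_borel m2.warped"
    have G: "rel_tvar \<xi>1' u = rel_tvar \<xi>2' u" if "u \<in> {0..1}" for u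
      by (rule rel_tvar_eq_if_distr_eq[OF model1 model2 eq that])
    \<comment> \<open>The inverse on [0,1] involves \<open>rel_tvar\<close> at points of [0,1] only,
      where the two functions are known to agree.\<close>
    then have "the_inv_into {0..1} (rel_tvar \<xi>1') = the_inv_into {0..1} (rel_tvar \<xi>2')"
      unfolding the_inv_into_def by (intro ext arg_cong[where f = The]) auto
    with G have "m1.unwarp = m2.unwarp"
      unfolding m1.unwarp_def m2.unwarp_def by (intro ext) (simp cong: if_cong)
    then have P: "distr M1 (fun_borel \<Otimes>\<^sub>M fun_borel) (\<lambda>\<omega>. (m1.f \<omega>, h1 \<omega>))
        = distr M2 (fun_borel \<Otimes>\<^sub>M fun_borel) (\<lambda>\<omega>. (m2.f \<omega>, h2 \<omega>))"
      using m1.distr_f_h_eq_unwarp m2.distr_f_h_eq_unwarp eq by simp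
    show "distr M1 c1_pair_borel (\<lambda>\<omega>. (m1.f \<omega>, h1 \<omega>)) = distr M2 c1_pair_borel (\<lambda>\<omega>. (m2.f \<omega>, h2 \<omega>))"
    \<comment> \<open>Each Borel set of pairs is the trace of a set of the product space, on which
      the two laws agree by \<open>P\<close>.\<close>
    proof (rule measure_eqI)
      fix A assume "A \<in> sets (distr M1 c1_pair_borel (\<lambda>\<omega>. (m1.f \<omega>, h1 \<omega>)))"
      then obtain B where "B \<in> sets (fun_borel \<Otimes>\<^sub>M fun_borel)" "A = (C1 \<times> C1) \<inter> B"
        unfolding sets_distr sets_c1_pair_borel sets_restrict_space by (elim imageE)
      then show "emeasure (distr M1 c1_pair_borel (\<lambda>\<omega>. (m1.f \<omega>, h1 \<omega>))) A
          = emeasure (distr M2 c1_pair_borel (\<lambda>\<omega>. (m2.f \<omega>, h2 \<omega>))) A"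
        using m1.emeasure_distr_f_h m2.emeasure_distr_f_h P by simp
    qed simp
  next
    assume "distr M1 c1_pair_borel (\<lambda>\<omega>. (m1.f \<omega>, h1 \<omega>)) = distr M2 c1_pair_borel (\<lambda>\<omega>. (m2.f \<omega>, h2 \<omega>))"
    then show "distr M1 c1_borel m1.warped = distr M2 c1_borel m2.warped"
      unfolding m1.distr_warped_eq m2.distr_warped_eq by simp
  qed
qed

end
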